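(* Let $m\ge 1$ be an integer and let $r\in\{1,\dots,m\}$ satisfy $r\le 3$ or $m-3\le r\le m$. Let $\boldsymbol{a}_m=(a_0,\dots,a_{m-1})\in(0,\infty)^m$ with $a_0\ge a_1\ge\dots\ge a_{m-1}$. Then for every permutation $\sigma$ of $\{0,1,\dots,m-1\}$, \[P_r(\sigma_{\mathrm{greedy}};\boldsymbol{a}_m)\ \ge\ P_r(\sigma;\boldsymbol{a}_m).\]
   Context: For a vector $\boldsymbol{a}_m=(a_0,\dots,a_{m-1})\in(0,\infty)^m$, an integer $r\in\{1,\dots,m\}$ and a permutation (bijection) $\sigma$ of $\{0,1,\dots,m-1\}$, define \[P_r(\sigma;\boldsymbol{a}_m)=\sum_{k=0}^{m-1}\prod_{i=0}^{r-1}a_{\sigma^{-1}(k+i)},\] where the argument $k+i$ is interpreted modulo $m$. The greedy permutation $\sigma_{\mathrm{greedy}}$ of $\{0,1,\dots,m-1\}$ is the permutation determined by \[\sigma_{\mathrm{greedy}}^{-1}(i)=2i,\qquad \sigma_{\mathrm{greedy}}^{-1}(m-1-i)=2i+1,\qquad i=0,1,\dots,\lfloor m/2\rfloor-1,\] together with, when $m$ is odd, $\sigma_{\mathrm{greedy}}^{-1}((m-1)/2)=m-1$. Thus $(a_{\sigma_{\mathrm{greedy}}^{-1}(0)},\dots,a_{\sigma_{\mathrm{greedy}}^{-1}(m-1)})$ is the circular symmetric ordering $(a_0,a_2,a_4,\dots,a_5,a_3,a_1)$. *)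

theory Defs
  imports Complex_Main "HOL-Combinatorics.Permutations"
begin

text \<open>
  Vectors with \<open>m\<close> entries are functions on \<open>nat\<close>, read only at the indices \<open>{..<m}\<close>.
  Permutations of \<open>{0, \<dots>, m - 1}\<close> are functions \<open>\<sigma>\<close> with \<open>\<sigma> permutes {..<m}\<close>; such a
  \<open>\<sigma>\<close> is the identity outside \<open>{..<m}\<close>, so \<open>inv \<sigma>\<close> is its inverse permutation.
\<close>

definition cyclic_sum :: "nat \<Rightarrow> nat \<Rightarrow> (nat \<Rightarrow> nat) \<Rightarrow> (nat \<Rightarrow> real) \<Rightarrow> real" where
  "cyclic_sum m r \<sigma> a = (\<Sum>k<m. \<Prod>i<r. a (inv \<sigma> ((k + i) mod m)))"

text \<open>
  The greedy permutation is prescribed through its inverse. The third case below covers the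
  positions \<open>m - 1 - i\<close> with \<open>i < m div 2\<close>; \<open>inv_greedy\<close> states the
  equations that determine \<open>greedy m\<close>.  The circular ordering of the entries of \<open>a\<close> is
  \<open>a 0, a 2, a 4, \<dots>, a 5, a 3, a 1\<close>.
\<close>

definition greedy_inv :: "nat \<Rightarrow> nat \<Rightarrow> nat" where
  "greedy_inv m j =
     (if j < m div 2 then 2 * j
      else if odd m \<and> j = (m - 1) div 2 then m - 1
      else if j < m then 2 * (m - 1 - j) + 1
      else j)"

definition greedy :: "nat \<Rightarrow> nat \<Rightarrow> nat" where
  "greedy m = inv (greedy_inv m)"

lemma greedy_inv_permutes: "greedy_inv m permutes {..<m}"
proof (rule bij_imp_permutes)
  have maps: "greedy_inv m j < m" if "j < m" for j
    using that unfolding greedy_inv_def by (auto split: if_splits)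
  have inj: "j = k" if "j < m" "k < m" "greedy_inv m j = greedy_inv m k" for j k
  proof -
    have pos: "j = (if even (greedy_inv m j) then greedy_inv m j div 2
                    else m - 1 - greedy_inv m j div 2)" if "j < m" for j
      using that unfolding greedy_inv_def by (auto split: if_splits)
    show ?thesis
      using pos[of j] pos[of k] that by metis
  qed
  have "greedy_inv m ` {..<m} = {..<m}"
    by (rule endo_inj_surj) (use maps inj in \<open>auto simp: inj_on_def\<close>)
  then show "bij_betw (greedy_inv m) {..<m} {..<m}"
    using inj by (auto simp: bij_betw_def inj_on_def)
qed (auto simp: greedy_inv_def elim!: oddE)

lemma greedy_permutes: "greedy m permutes {..<m}"
  by (simp add: greedy_def greedy_inv_permutes permutes_inv)

lemma inv_greedy_eq: "inv (greedy m) = greedy_inv m"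
  unfolding greedy_def by (rule permutes_inv_inv[OF greedy_inv_permutes])

lemma inv_greedy:
  "i < m div 2 \<Longrightarrow> inv (greedy m) i = 2 * i"
  "i < m div 2 \<Longrightarrow> inv (greedy m) (m - 1 - i) = 2 * i + 1"
  "odd m \<Longrightarrow> inv (greedy m) ((m - 1) div 2) = m - 1"
  unfolding inv_greedy_eq greedy_inv_def by (auto elim!: oddE)

end

theory Submission
  imports Defs
begin

text \<open>
  The proof is by polarization (two-point symmetrization) on the cycle \<open>\<int>/m\<close>. Fix a reflection of
  the cycle; for every pair of mirror positions, put the larger entry on the side that contains the
  centre of the greedy ordering. A window of \<open>r\<close> consecutive positions splits into a mirror-symmetric
  part, whose product does not change, and a part that lies on one side of the axis; so, after adding
  the mirror window, the inequality \<open>\<Prod>u + \<Prod>v \<le> \<Prod>max u v + \<Prod>min u v\<close> shows that the cyclic sum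
  does not decrease. Any two positions are mirror images under some reflection, so an ordering that
  no polarization changes is the greedy one, and each other polarization strictly decreases a potential.
\<close>

section \<open>A two-point inequality for products\<close>

text \<open>Induction on \<open>D\<close>. Of the two new factors, the smaller is common to both
  terms and multiplies the induction hypothesis; the excess of the larger multiplies
  \<open>U \<le> P\<close> or \<open>V \<le> P\<close>.\<close>

lemma prod_add_prod_le_max_min:
  fixes u v :: "'a \<Rightarrow> real"
  assumes "finite D" and "\<And>x. x \<in> D \<Longrightarrow> 0 \<le> u x" and "\<And>x. x \<in> D \<Longrightarrow> 0 \<le> v x"
  shows "prod u D + prod v D \<le> (\<Prod>x\<in>D. max (u x) (v x)) + (\<Prod>x\<in>D. min (u x) (v x))"
  using assms
proof (induction D rule: finite_induct)
  case (insert d D)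
  define U V P Q where "U = prod u D" and "V = prod v D"
    and "P = (\<Prod>x\<in>D. max (u x) (v x))" and "Q = (\<Prod>x\<in>D. min (u x) (v x))"
  have IH: "U + V \<le> P + Q"
    unfolding U_def V_def P_def Q_def using insert by simp
  have UP: "U \<le> P" and VP: "V \<le> P"
    unfolding U_def V_def P_def using insert.prems by (auto intro!: prod_mono)
  have "u d * U + v d * V \<le> max (u d) (v d) * P + min (u d) (v d) * Q"
  proof (cases "v d \<le> u d")
    case True
    have "v d * (U + V) \<le> v d * (P + Q)" "(u d - v d) * U \<le> (u d - v d) * P"
      using IH UP True insert.prems by (auto intro!: mult_left_mono)
    then show ?thesis using True by (simp add: max_def min_def algebra_simps)
  next
    case False
    have "u d * (U + V) \<le> u d * (P + Q)" "(v d - u d) * V \<le> (v d - u d) * P"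
      using IH VP False insert.prems by (auto intro!: mult_left_mono)
    then show ?thesis using False by (simp add: max_def min_def algebra_simps)
  qed
  then show ?case
    using insert.hyps by (simp add: U_def V_def P_def Q_def)
qed simp

section \<open>Reflections and windows on the cycle\<close>

text \<open>The reflection \<open>x \<mapsto> s - x\<close> of \<open>\<int>/m\<close>, for \<open>s, x < m\<close>.\<close>

definition reflect :: "nat \<Rightarrow> nat \<Rightarrow> nat \<Rightarrow> nat" where
  "reflect m s x = (if x \<le> s then s - x else s + m - x)"

lemma reflect_less: "s < m \<Longrightarrow> x < m \<Longrightarrow> reflect m s x < m"
  and reflect_reflect: "s < m \<Longrightarrow> x < m \<Longrightarrow> reflect m s (reflect m s x) = x"
  by (auto simp: reflect_def)

lemma bij_betw_reflect: "s < m \<Longrightarrow> bij_betw (reflect m s) {..<m} {..<m}"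
  by (rule bij_betw_byWitness[where f' = "reflect m s"]) (auto simp: reflect_less reflect_reflect)

text \<open>The window of \<open>r\<close> positions starting at \<open>k\<close>, with its wrapped
  part as second disjunct. Without \<open>mod\<close>, facts about membership reduce to linear
  arithmetic.\<close>

definition arc :: "nat \<Rightarrow> nat \<Rightarrow> nat \<Rightarrow> nat set" where
  "arc m r k = {z. z < m \<and> (k \<le> z \<and> z < k + r \<or> z + m < k + r)}"

lemma finite_arc: "finite (arc m r k)"
  by (simp add: arc_def)

lemma prod_window_eq_prod_arc:
  assumes "k < m" and "r \<le> m"
  shows "(\<Prod>i<r. f ((k + i) mod m)) = prod f (arc m r k)"
proof (rule prod.reindex_bij_betw)
  have *: "(k + i) mod m = (if k + i < m then k + i else k + i - m)" if "i < r" for i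
    using assms that by (simp add: mod_if)
  show "bij_betw (\<lambda>i. (k + i) mod m) {..<r} (arc m r k)"
  proof (rule bij_betw_byWitness[where f' = "\<lambda>z. if k \<le> z then z - k else z + m - k"])
    show "\<forall>i\<in>{..<r}. (if k \<le> (k + i) mod m then (k + i) mod m - k else (k + i) mod m + m - k) = i"
      using assms by (auto simp: *)
    show "\<forall>z\<in>arc m r k. (k + (if k \<le> z then z - k else z + m - k)) mod m = z"
      using assms by (auto simp: arc_def)
    show "(\<lambda>i. (k + i) mod m) ` {..<r} \<subseteq> arc m r k"
      using assms by (auto simp: * arc_def)
    show "(\<lambda>z. if k \<le> z then z - k else z + m - k) ` arc m r k \<subseteq> {..<r}"
      using assms by (auto simp: arc_def)
  qed
qed

text \<open>A reflection reverses a window, so the image starts at the mirror image of the last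
  position \<open>k + r - 1\<close>. Modulo \<open>m\<close> this is
  \<open>s - (k + r - 1) = t - k\<close>: starting points are reflected too.\<close>

lemma reflect_image_arc:
  assumes "s < m" "k < m" "1 \<le> r" "r \<le> m"
  defines "t \<equiv> (if r \<le> s + 1 then s + 1 - r else s + 1 + m - r)"
  shows "reflect m s ` arc m r k = arc m r (reflect m t k)"
proof -
  have "reflect m s z \<in> arc m r (reflect m t k) \<longleftrightarrow> z \<in> arc m r k" if "z < m" for z
    using assms that unfolding arc_def reflect_def t_def mem_Collect_eq
    by (auto split: if_splits)
  then show ?thesis
    using reflect_less[OF assms(1)] reflect_reflect[OF assms(1)]
    by (auto simp: arc_def image_iff) metis+
qed

text \<open>The two open sides of the axis of \<open>reflect m s\<close> are \<open>s < 2x < s + m\<close> and its mirror image.\<close>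

lemma greedy_inv_less_reflect_iff:
  assumes "s < m" "x < m"
  shows "greedy_inv m x < greedy_inv m (reflect m s x) \<longleftrightarrow> 2 * x < s \<or> s + m < 2 * x"
proof -
  \<comment> \<open>On a circle of length \<open>m\<close>, this is twice the distance from
    \<open>j\<close> to the point -1/4, minus 1/2. That point lies on no axis, so of two mirror
    positions the one on its side has the smaller value. For odd \<open>m\<close> the middle
    position falls under the first branch.\<close>
  have *: "greedy_inv m j = (if 2 * j < m then 2 * j else 2 * m - 1 - 2 * j)" if "j < m" for j
    using that unfolding greedy_inv_def by (auto elim!: oddE)
  show ?thesis
    unfolding *[OF assms(2)] *[OF reflect_less[OF assms]] using assms by (auto simp: reflect_def)
qed

text \<open>The positions whose mirror image leaves the window form a difference of two arcs of
  equal length, which is again an arc. It is disjoint from its mirror image, so it cannot cross the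
  axis.\<close>

lemma arc_one_sided:
  assumes "s < m" "k < m" "r \<le> m"
    and "x \<in> arc m r k" "reflect m s x \<notin> arc m r k"
    and "y \<in> arc m r k" "reflect m s y \<notin> arc m r k"
    and "2 * x < s \<or> s + m < 2 * x"
  shows "2 * y < s \<or> s + m < 2 * y"
  using assms unfolding arc_def reflect_def mem_Collect_eq
  by (auto split: if_splits)

section \<open>Polarization of an ordering\<close>

text \<open>Here \<open>\<tau>\<close> stands for an inverse permutation: \<open>\<tau> x\<close> is
  the index of the entry at position \<open>x\<close>. Comparing indices instead of entries keeps
  ties in \<open>a\<close> from mattering.\<close>

definition misplaced :: "nat \<Rightarrow> nat \<Rightarrow> (nat \<Rightarrow> nat) \<Rightarrow> nat \<Rightarrow> bool" where
  "misplaced m s \<tau> x \<longleftrightarrow> x < m \<and>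
     (greedy_inv m x < greedy_inv m (reflect m s x)) \<noteq> (\<tau> x < \<tau> (reflect m s x))"

definition flip :: "nat \<Rightarrow> nat \<Rightarrow> (nat \<Rightarrow> nat) \<Rightarrow> nat \<Rightarrow> nat" where
  "flip m s \<tau> x = (if misplaced m s \<tau> x then reflect m s x else x)"

text \<open>Exchanging \<open>x\<close> with its mirror image negates both comparisons, by
  injectivity, unless \<open>x\<close> is fixed. Hence \<open>flip\<close> swaps whole mirror pairs
  and is an involution.\<close>

lemma misplaced_reflect:
  assumes "\<tau> permutes {..<m}" "s < m" "x < m"
  shows "misplaced m s \<tau> (reflect m s x) \<longleftrightarrow> misplaced m s \<tau> x"
proof -
  have "greedy_inv m x = greedy_inv m (reflect m s x) \<longleftrightarrow> x = reflect m s x"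
    "\<tau> x = \<tau> (reflect m s x) \<longleftrightarrow> x = reflect m s x"
    using permutes_inj[OF greedy_inv_permutes] permutes_inj[OF assms(1)] by (auto simp: inj_eq)
  then show ?thesis
    using assms(2,3) by (auto simp: misplaced_def reflect_less reflect_reflect)
qed

lemma flip_permutes:
  assumes "\<tau> permutes {..<m}" "s < m"
  shows "flip m s \<tau> permutes {..<m}"
proof (rule bij_imp_permutes)
  show "bij_betw (flip m s \<tau>) {..<m} {..<m}"
    by (rule bij_betw_byWitness[where f' = "flip m s \<tau>"])
      (use assms in \<open>auto simp: flip_def reflect_less reflect_reflect misplaced_reflect\<close>)
qed (simp add: flip_def misplaced_def)

lemma flip_max_min:
  fixes a :: "nat \<Rightarrow> real"
  assumes "\<tau> permutes {..<m}" "s < m" "x < m"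
    and "\<And>i j. i \<le> j \<Longrightarrow> j < m \<Longrightarrow> a j \<le> a i"
    and "greedy_inv m x < greedy_inv m (reflect m s x)"
  shows "a (\<tau> (flip m s \<tau> x)) = max (a (\<tau> x)) (a (\<tau> (reflect m s x)))"
    and "a (\<tau> (flip m s \<tau> (reflect m s x))) = min (a (\<tau> x)) (a (\<tau> (reflect m s x)))"
proof -
  have "\<tau> x < m" "\<tau> (reflect m s x) < m"
    using permutes_in_image[OF assms(1)] assms(2,3) by (simp_all add: reflect_less)
  then have "\<tau> x < \<tau> (reflect m s x) \<Longrightarrow> a (\<tau> (reflect m s x)) \<le> a (\<tau> x)"
    "\<not> \<tau> x < \<tau> (reflect m s x) \<Longrightarrow> a (\<tau> x) \<le> a (\<tau> (reflect m s x))"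
    by (simp_all add: assms(4))
  then show "a (\<tau> (flip m s \<tau> x)) = max (a (\<tau> x)) (a (\<tau> (reflect m s x)))"
    "a (\<tau> (flip m s \<tau> (reflect m s x))) = min (a (\<tau> x)) (a (\<tau> (reflect m s x)))"
    using assms(1-3,5)
    by (auto simp: flip_def misplaced_reflect reflect_reflect, auto simp: misplaced_def)
qed

section \<open>Effect of a polarization on the cyclic sum\<close>

text \<open>Apply \<open>prod_add_prod_le_max_min\<close> to the entries on \<open>D\<close> and
  those at the mirror positions: the flip collects all maxima on one side and all minima on the
  other.\<close>

lemma prod_one_sided_le_flip:
  fixes a :: "nat \<Rightarrow> real"
  assumes "\<tau> permutes {..<m}" "s < m" "D \<subseteq> {..<m}"
    and "\<And>i j. i \<le> j \<Longrightarrow> j < m \<Longrightarrow> a j \<le> a i"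
    and "\<And>i. i < m \<Longrightarrow> 0 \<le> a i"
    and side: "(\<forall>x\<in>D. greedy_inv m x < greedy_inv m (reflect m s x)) \<or>
      (\<forall>x\<in>D. greedy_inv m (reflect m s x) < greedy_inv m x)"
  shows "(\<Prod>x\<in>D. a (\<tau> x)) + (\<Prod>x\<in>D. a (\<tau> (reflect m s x)))
    \<le> (\<Prod>x\<in>D. a (\<tau> (flip m s \<tau> x))) + (\<Prod>x\<in>D. a (\<tau> (flip m s \<tau> (reflect m s x))))"
proof -
  have lt: "x < m" if "x \<in> D" for x
    using assms(3) that by auto
  have nonneg: "0 \<le> a (\<tau> x)" if "x < m" for x
    using permutes_in_image[OF assms(1)] that by (simp add: assms(5))
  have le: "(\<Prod>x\<in>D. a (\<tau> x)) + (\<Prod>x\<in>D. a (\<tau> (reflect m s x)))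
    \<le> (\<Prod>x\<in>D. max (a (\<tau> x)) (a (\<tau> (reflect m s x))))
      + (\<Prod>x\<in>D. min (a (\<tau> x)) (a (\<tau> (reflect m s x))))"
    using assms(2,3)
    by (intro prod_add_prod_le_max_min) (auto intro!: nonneg simp: lt reflect_less intro: finite_subset)
  have mm: "a (\<tau> (flip m s \<tau> x)) = max (a (\<tau> x)) (a (\<tau> (reflect m s x)))"
    "a (\<tau> (flip m s \<tau> (reflect m s x))) = min (a (\<tau> x)) (a (\<tau> (reflect m s x)))"
    if "x < m" "greedy_inv m x < greedy_inv m (reflect m s x)" for x
    using assms(1,2,4) that by (intro flip_max_min; simp)+
  from side show ?thesis
  proof
    assume "\<forall>x\<in>D. greedy_inv m x < greedy_inv m (reflect m s x)"
    then show ?thesis using le by (simp add: mm lt)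
  next
    assume *: "\<forall>x\<in>D. greedy_inv m (reflect m s x) < greedy_inv m x"
    have "a (\<tau> (flip m s \<tau> x)) = min (a (\<tau> x)) (a (\<tau> (reflect m s x)))"
      "a (\<tau> (flip m s \<tau> (reflect m s x))) = max (a (\<tau> x)) (a (\<tau> (reflect m s x)))"
      if "x \<in> D" for x
      \<comment> \<open>On the far side the roles are exchanged: \<open>mm\<close> is used at the
        mirror position, whose own mirror image is \<open>x\<close>.\<close>
      using mm[of "reflect m s x"] * that assms(2) lt[OF that]
      by (auto simp: reflect_less reflect_reflect max.commute min.commute)
    then show ?thesis using le by simp
  qed
qed

lemma prod_arc_le_flip:
  fixes a :: "nat \<Rightarrow> real"
  assumes "\<tau> permutes {..<m}" "s < m" "k < m" "r \<le> m"
    and "\<And>i j. i \<le> j \<Longrightarrow> j < m \<Longrightarrow> a j \<le> a i"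
    and "\<And>i. i < m \<Longrightarrow> 0 \<le> a i"
  shows "(\<Prod>x\<in>arc m r k. a (\<tau> x)) + (\<Prod>x\<in>reflect m s ` arc m r k. a (\<tau> x))
    \<le> (\<Prod>x\<in>arc m r k. a (\<tau> (flip m s \<tau> x)))
      + (\<Prod>x\<in>reflect m s ` arc m r k. a (\<tau> (flip m s \<tau> x)))"
proof -
  define A where "A = arc m r k"
  define C where "C = {x \<in> A. reflect m s x \<in> A}"
  define D where "D = {x \<in> A. reflect m s x \<notin> A}"
  have lt: "x < m" if "x \<in> A" for x
    using that by (simp add: A_def arc_def)
  have fin: "finite C" "finite D"
    unfolding C_def D_def A_def by (simp_all add: finite_arc)
  have inj: "inj_on (reflect m s) {..<m}"
    using bij_betw_reflect[OF assms(2)] by (rule bij_betw_imp_inj_on)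
  have sub: "C \<subseteq> {..<m}" "D \<subseteq> {..<m}"
    using lt by (auto simp: C_def D_def)
  have A: "A = C \<union> D" "C \<inter> D = {}"
    by (auto simp: C_def D_def)
  have C_image: "reflect m s ` C = C"
  proof
    show 1: "reflect m s ` C \<subseteq> C"
      using assms(2) lt by (auto simp: C_def reflect_reflect)
    show "C \<subseteq> reflect m s ` C"
    proof
      fix x assume "x \<in> C"
      then have "reflect m s x \<in> C" "x = reflect m s (reflect m s x)"
        using 1 sub assms(2) by (auto simp: reflect_reflect)
      then show "x \<in> reflect m s ` C" by blast
    qed
  qed
  then have image_A: "reflect m s ` A = C \<union> reflect m s ` D"
    by (simp add: A image_Un)
  have disj: "C \<inter> reflect m s ` D = {}"
    using assms(2) lt by (auto simp: C_def D_def reflect_reflect)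
  \<comment> \<open>The window and its mirror image share \<open>C\<close>, which factors out and
    leaves only the one-sided products.\<close>
  have split: "prod g A + prod g (reflect m s ` A) =
      prod g C * (prod g D + (\<Prod>x\<in>D. g (reflect m s x)))" for g :: "nat \<Rightarrow> real"
    unfolding image_A unfolding A(1)
    using fin A(2) disj inj_on_subset[OF inj sub(2)]
    by (simp add: prod.union_disjoint prod.reindex algebra_simps)
  \<comment> \<open>The flip permutes the symmetric set \<open>C\<close>, so the common factor is
    unchanged.\<close>
  have C_flip: "(\<Prod>x\<in>C. a (\<tau> (flip m s \<tau> x))) = (\<Prod>x\<in>C. a (\<tau> x))"
  proof (rule prod.reindex_bij_betw)
    show "bij_betw (flip m s \<tau>) C C"
    proof (rule bij_betw_byWitness[where f' = "flip m s \<tau>"])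
      show "flip m s \<tau> ` C \<subseteq> C" "flip m s \<tau> ` C \<subseteq> C"
        using C_image by (auto simp: flip_def)
    qed (use assms(1,2) sub(1) in \<open>auto simp: flip_def reflect_reflect misplaced_reflect subset_iff\<close>)
  qed
  have ne: "greedy_inv m x \<noteq> greedy_inv m (reflect m s x)" if "x \<in> D" for x
    using permutes_inj[OF greedy_inv_permutes, of m] that by (auto simp: D_def inj_eq)
  have iff: "greedy_inv m x < greedy_inv m (reflect m s x) \<longleftrightarrow> 2 * x < s \<or> s + m < 2 * x"
    if "x \<in> D" for x
    using greedy_inv_less_reflect_iff assms(2) sub that by blast
  have "(\<forall>x\<in>D. greedy_inv m x < greedy_inv m (reflect m s x)) \<or>
      (\<forall>x\<in>D. \<not> greedy_inv m x < greedy_inv m (reflect m s x))"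
    using iff arc_one_sided[OF assms(2-4)] unfolding D_def A_def by blast
  then have "(\<forall>x\<in>D. greedy_inv m x < greedy_inv m (reflect m s x)) \<or>
      (\<forall>x\<in>D. greedy_inv m (reflect m s x) < greedy_inv m x)"
    using ne by (meson linorder_neqE_nat)
  note D_le = prod_one_sided_le_flip[OF assms(1,2) sub(2) assms(5,6) this]
  have "0 \<le> a (\<tau> x)" if "x \<in> C" for x
    using permutes_in_image[OF assms(1)] that sub(1) by (auto intro!: assms(6) simp: subset_iff)
  then have "0 \<le> (\<Prod>x\<in>C. a (\<tau> x))"
    by (rule prod_nonneg)
  then show ?thesis
    unfolding A_def[symmetric] split C_flip using D_le by (intro mult_left_mono)
qed

lemma sum_prod_arc_le_flip:
  fixes a :: "nat \<Rightarrow> real"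
  assumes "\<tau> permutes {..<m}" "s < m" "1 \<le> r" "r \<le> m"
    and "\<And>i j. i \<le> j \<Longrightarrow> j < m \<Longrightarrow> a j \<le> a i"
    and "\<And>i. i < m \<Longrightarrow> 0 \<le> a i"
  shows "(\<Sum>k<m. \<Prod>x\<in>arc m r k. a (\<tau> x)) \<le> (\<Sum>k<m. \<Prod>x\<in>arc m r k. a (\<tau> (flip m s \<tau> x)))"
proof -
  define t where "t = (if r \<le> s + 1 then s + 1 - r else s + 1 + m - r)"
  have "t < m"
    using assms(2-4) by (auto simp: t_def)
  \<comment> \<open>The mirror windows run through all windows again, since
    \<open>reflect m t\<close> permutes the starting points.\<close>
  have double: "2 * (\<Sum>k<m. prod g (arc m r k)) =
      (\<Sum>k<m. prod g (arc m r k) + prod g (reflect m s ` arc m r k))" for g :: "nat \<Rightarrow> real"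
  proof -
    have "(\<Sum>k<m. prod g (reflect m s ` arc m r k)) = (\<Sum>k<m. prod g (arc m r (reflect m t k)))"
      using reflect_image_arc assms(2-4) by (intro sum.cong) (auto simp: t_def)
    also have "\<dots> = (\<Sum>k<m. prod g (arc m r k))"
      by (rule sum.reindex_bij_betw[OF bij_betw_reflect[OF \<open>t < m\<close>]])
    finally show ?thesis by (simp add: sum.distrib)
  qed
  have "2 * (\<Sum>k<m. \<Prod>x\<in>arc m r k. a (\<tau> x)) \<le> 2 * (\<Sum>k<m. \<Prod>x\<in>arc m r k. a (\<tau> (flip m s \<tau> x)))"
    unfolding double using assms by (intro sum_mono prod_arc_le_flip) auto
  then show ?thesis by simp
qed

section \<open>A potential that polarization decreases\<close>

text \<open>The weights \<open>m - greedy_inv m x\<close> are positive and largest near the greedy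
  centre, so large indices there are penalized.\<close>

definition potential :: "nat \<Rightarrow> (nat \<Rightarrow> nat) \<Rightarrow> nat" where
  "potential m \<tau> = (\<Sum>x<m. \<tau> x * (m - greedy_inv m x))"

text \<open>On a misplaced pair the indices and the weights are sorted the same way; exchanging the
  indices lowers the sum by the rearrangement inequality.\<close>

lemma potential_flip_less:
  assumes "\<tau> permutes {..<m}" "s < m" "misplaced m s \<tau> x"
  shows "potential m (\<tau> \<circ> flip m s \<tau>) < potential m \<tau>"
proof -
  define w where "w x = m - greedy_inv m x" for x
  have double: "2 * (\<Sum>x<m. g x) = (\<Sum>x<m. g x + g (reflect m s x))" for g :: "nat \<Rightarrow> nat"
    using sum.reindex_bij_betw[OF bij_betw_reflect[OF assms(2)], of g] by (simp add: sum.distrib)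
  have swap: "\<tau> (reflect m s x) * w x + \<tau> x * w (reflect m s x)
      < \<tau> x * w x + \<tau> (reflect m s x) * w (reflect m s x)" if "misplaced m s \<tau> x" for x
  proof -
    have x: "x < m" and neq: "x \<noteq> reflect m s x"
      using that by (auto simp: misplaced_def)
    then have ne: "greedy_inv m x \<noteq> greedy_inv m (reflect m s x)" "\<tau> x \<noteq> \<tau> (reflect m s x)"
      using permutes_inj[OF greedy_inv_permutes, of m] permutes_inj[OF assms(1)]
      by (auto simp: inj_eq)
    have lt: "greedy_inv m x < m" "greedy_inv m (reflect m s x) < m"
      using permutes_in_image[OF greedy_inv_permutes, of m] x assms(2)
      by (simp_all add: reflect_less)
    \<comment> \<open>The two sides differ by \<open>(d - b) * (c - e)\<close>, which is
      \<open>i * j\<close> below.\<close>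
    have rearr: "b * c + d * e < d * c + b * e" if "b < d" "e < c" for b c d e :: nat
    proof -
      obtain i where "d = b + i" "0 < i"
        using less_imp_add_positive[OF \<open>b < d\<close>] by metis
      moreover obtain j where "c = e + j" "0 < j"
        using less_imp_add_positive[OF \<open>e < c\<close>] by metis
      ultimately show ?thesis by (simp add: algebra_simps)
    qed
    from ne that consider "\<tau> (reflect m s x) < \<tau> x" "w (reflect m s x) < w x"
      | "\<tau> x < \<tau> (reflect m s x)" "w x < w (reflect m s x)"
      using lt unfolding misplaced_def w_def by linarith
    then show ?thesis
    proof cases
      case 1
      then show ?thesis by (rule rearr)
    next
      case 2
      then show ?thesis using rearr[of "\<tau> x" "\<tau> (reflect m s x)" "w x" "w (reflect m s x)"] by simp
    qed
  qed
  have "2 * potential m (\<tau> \<circ> flip m s \<tau>) < 2 * potential m \<tau>"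
    unfolding potential_def double w_def[symmetric]
  proof (rule sum_strict_mono_ex1)
    have flip: "\<tau> (flip m s \<tau> y) * w y + \<tau> (flip m s \<tau> (reflect m s y)) * w (reflect m s y) =
      (if misplaced m s \<tau> y then \<tau> (reflect m s y) * w y + \<tau> y * w (reflect m s y)
       else \<tau> y * w y + \<tau> (reflect m s y) * w (reflect m s y))" if "y < m" for y
      using that assms(1,2) by (simp add: flip_def misplaced_reflect reflect_reflect)
    show "\<forall>y\<in>{..<m}. (\<tau> \<circ> flip m s \<tau>) y * w y + (\<tau> \<circ> flip m s \<tau>) (reflect m s y) * w (reflect m s y)
      \<le> \<tau> y * w y + \<tau> (reflect m s y) * w (reflect m s y)"
      using swap by (auto simp: flip less_imp_le)
    have "x < m"
      using assms(3) by (simp add: misplaced_def)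
    then show "\<exists>y\<in>{..<m}. (\<tau> \<circ> flip m s \<tau>) y * w y
        + (\<tau> \<circ> flip m s \<tau>) (reflect m s y) * w (reflect m s y)
      < \<tau> y * w y + \<tau> (reflect m s y) * w (reflect m s y)"
      using swap[OF assms(3)] assms(3) by (intro bexI[of _ x]) (auto simp: flip)
  qed simp
  then show ?thesis by simp
qed

section \<open>Descent to the greedy ordering\<close>

text \<open>The value of a permutation at \<open>x\<close> is the number of positions with smaller
  value, so it is determined by the order alone.\<close>

lemma permutes_eq_if_same_order:
  fixes \<tau> \<rho> :: "nat \<Rightarrow> nat"
  assumes "\<tau> permutes {..<m}" "\<rho> permutes {..<m}"
    and "\<And>x y. x < m \<Longrightarrow> y < m \<Longrightarrow> \<tau> x < \<tau> y \<longleftrightarrow> \<rho> x < \<rho> y"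
  shows "\<tau> = \<rho>"
proof
  fix x
  have card: "card {z \<in> {..<m}. \<pi> z < \<pi> x} = \<pi> x" if "\<pi> permutes {..<m}" "x < m" for \<pi> :: "nat \<Rightarrow> nat"
  proof -
    have "\<pi> x < m"
      using permutes_in_image[OF that(1)] that(2) by simp
    have "\<pi> ` {z \<in> {..<m}. \<pi> z < \<pi> x} = {..<\<pi> x}"
    proof
      show "{..<\<pi> x} \<subseteq> \<pi> ` {z \<in> {..<m}. \<pi> z < \<pi> x}"
      proof
        fix y assume y: "y \<in> {..<\<pi> x}"
        then have "y \<in> \<pi> ` {..<m}"
          using \<open>\<pi> x < m\<close> by (simp add: permutes_image[OF that(1)])
        then show "y \<in> \<pi> ` {z \<in> {..<m}. \<pi> z < \<pi> x}"
          using y by auto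
      qed
    qed auto
    moreover have "inj_on \<pi> {z \<in> {..<m}. \<pi> z < \<pi> x}"
      using that(1) by (rule permutes_inj_on)
    ultimately show ?thesis
      by (metis card_image card_lessThan)
  qed
  show "\<tau> x = \<rho> x"
  proof (cases "x < m")
    case True
    then have "{z \<in> {..<m}. \<tau> z < \<tau> x} = {z \<in> {..<m}. \<rho> z < \<rho> x}"
      using assms(3) by auto
    then show ?thesis
      using card[OF assms(1) True] card[OF assms(2) True] by simp
  next
    case False
    then show ?thesis
      using assms(1,2) by (simp add: permutes_not_in)
  qed
qed

lemma exists_misplaced:
  assumes "\<tau> permutes {..<m}" "\<tau> \<noteq> greedy_inv m"
  obtains s x where "s < m" "misplaced m s \<tau> x"
proof -
  obtain x y where xy: "x < m" "y < m"
    "\<not> (\<tau> x < \<tau> y \<longleftrightarrow> greedy_inv m x < greedy_inv m y)"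
    using permutes_eq_if_same_order[OF assms(1) greedy_inv_permutes] assms(2) by blast
  \<comment> \<open>The reflection that exchanges \<open>x\<close> and \<open>y\<close> has
    parameter \<open>x + y\<close> modulo \<open>m\<close>.\<close>
  define s where "s = (if x + y < m then x + y else x + y - m)"
  have "s < m" "reflect m s x = y"
    using xy(1,2) by (auto simp: s_def reflect_def)
  then show ?thesis
    using xy that[of s x] by (auto simp: misplaced_def)
qed

text \<open>Induction on the potential: while \<open>\<tau>\<close> is not greedy, polarizing at a
  misplaced position lowers the potential and does not lower the sum.\<close>

lemma sum_prod_arc_le_greedy_inv:
  fixes a :: "nat \<Rightarrow> real"
  assumes "\<tau> permutes {..<m}" "1 \<le> r" "r \<le> m"
    and "\<And>i j. i \<le> j \<Longrightarrow> j < m \<Longrightarrow> a j \<le> a i"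
    and "\<And>i. i < m \<Longrightarrow> 0 \<le> a i"
  shows "(\<Sum>k<m. \<Prod>x\<in>arc m r k. a (\<tau> x)) \<le> (\<Sum>k<m. \<Prod>x\<in>arc m r k. a (greedy_inv m x))"
  using assms(1)
proof (induction "potential m \<tau>" arbitrary: \<tau> rule: less_induct)
  case less
  show ?case
  proof (cases "\<tau> = greedy_inv m")
    case False
    then obtain s x where s: "s < m" and x: "misplaced m s \<tau> x"
      using exists_misplaced[OF less.prems] by blast
    have "(\<Sum>k<m. \<Prod>x\<in>arc m r k. a (\<tau> x)) \<le> (\<Sum>k<m. \<Prod>x\<in>arc m r k. a ((\<tau> \<circ> flip m s \<tau>) x))"
      using sum_prod_arc_le_flip[OF less.prems s assms(2-5)] by simp
    also have "\<dots> \<le> (\<Sum>k<m. \<Prod>x\<in>arc m r k. a (greedy_inv m x))"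
      using less.hyps potential_flip_less[OF less.prems s x]
        permutes_compose[OF flip_permutes[OF less.prems s] less.prems] by blast
    finally show ?thesis .
  qed simp
qed

lemma cyclic_sum_eq_sum_prod_arc:
  assumes "r \<le> m"
  shows "cyclic_sum m r \<sigma> a = (\<Sum>k<m. \<Prod>x\<in>arc m r k. a (inv \<sigma> x))"
  unfolding cyclic_sum_def
  using assms by (intro sum.cong) (auto simp: prod_window_eq_prod_arc[where f = "\<lambda>x. a (inv \<sigma> x)"])

theorem theorem2:
  fixes m r :: nat and a :: "nat \<Rightarrow> real" and \<sigma> :: "nat \<Rightarrow> nat"
  assumes "m \<ge> 1"
    and "1 \<le> r" and "r \<le> m"
    and "r \<le> 3 \<or> m \<le> r + 3"
    and "\<And>i. i < m \<Longrightarrow> a i > 0"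
    and "\<And>i j. i \<le> j \<Longrightarrow> j < m \<Longrightarrow> a i \<ge> a j"
    and "\<sigma> permutes {..<m}"
  shows "cyclic_sum m r (greedy m) a \<ge> cyclic_sum m r \<sigma> a"
  unfolding cyclic_sum_eq_sum_prod_arc[OF assms(3)] inv_greedy_eq
  using assms(2,3,5,6) permutes_inv[OF assms(7)]
  by (intro sum_prod_arc_le_greedy_inv) (auto intro: less_imp_le)

end
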